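(* Let $M$ be an isometrically immersed $n$-dimensional submanifold of codimension $r$ of an $(n+r)$-dimensional metallic Riemannian manifold $(\bar M,J,g)$ and let $\Sigma:=(T,g,\eta_\alpha,\xi_\alpha,(a_{\alpha\beta}))_{1\le\alpha,\beta\le r}$ be the induced structure on $M$. If $M$ is a proper slant submanifold with slant angle $\theta$, then $$T^2=\frac{1}{\tan^2(\theta)}\sum_{\alpha=1}^r\eta_\alpha\otimes\xi_\alpha.$$
   Context: A metallic Riemannian manifold $(\bar M,J,g)$ is a smooth manifold with a $(1,1)$-tensor field $J$ satisfying $J^2=pJ+qI$ for some positive integers $p,q$ and a Riemannian metric $g$ with $g(JX,Y)=g(X,JY)$ for all vector fields $X,Y$. Let $\{N_1,\dots,N_r\}$ be a (local) orthonormal frame of the normal bundle of $M$. The induced structure $\Sigma$ is defined by $JX=TX+\sum_\alpha\eta_\alpha(X)N_\alpha$ for $X\in\Gamma(TM)$ and $JN_\alpha=\xi_\alpha+\sum_\beta a_{\alpha\beta}N_\beta$, with $TX,\xi_\alpha$ tangent to $M$; $(\eta_\alpha\otimes\xi_\alpha)(X)=\eta_\alpha(X)\xi_\alpha$. $M$ is slant if for all $x\in M$ and nonzero $X_x\in T_xM$ the angle $\theta(X_x)\in[0,\pi/2]$ between $JX_x$ and $T_xM$ is a constant $\theta$ (independent of $x$ and $X_x$), called the slant angle; $\cos\theta(X_x)=\|TX_x\|/\|JX_x\|$. It is proper slant if it is neither invariant ($J(T_xM)\subset T_xM$ for all $x$; $\theta=0$) nor anti-invariant ($J(T_xM)\subset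 T_xM^\perp$ for all $x$; $\theta=\pi/2$). *)

theory Defs
  imports "HOL-Analysis.Analysis" "HOL-Library.Function_Algebras"
begin

section \<open>Smooth functions between Euclidean spaces\<close>

text \<open>\<open>S\<close> is meant to be open.  A function is \<open>C\<^sup>k\<^sup>+\<^sup>1\<close> iff it is (Frechet) differentiable and all its
  directional derivatives are \<open>C\<^sup>k\<close>.\<close>

primrec Ck_on :: "nat \<Rightarrow> 'a::euclidean_space set \<Rightarrow> ('a \<Rightarrow> 'b::euclidean_space) \<Rightarrow> bool" where
  "Ck_on 0 S h \<longleftrightarrow> continuous_on S h"
| "Ck_on (Suc k) S h \<longleftrightarrow>
     (\<forall>x\<in>S. h differentiable (at x)) \<and>
     (\<forall>v. Ck_on k S (\<lambda>x. frechet_derivative h (at x) v))"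

definition smooth_on :: "'a::euclidean_space set \<Rightarrow> ('a \<Rightarrow> 'b::euclidean_space) \<Rightarrow> bool" where
  "smooth_on S h \<longleftrightarrow> (\<forall>k. Ck_on k S h)"


section \<open>Smooth manifolds\<close>

text \<open>A chart is a pair of a domain and a coordinate map; the values of the coordinate map outside
  the domain are irrelevant.\<close>

type_synonym ('m, 'a) chart = "'m set \<times> ('m \<Rightarrow> 'a)"

record ('m, 'a) manifold =
  topo :: "'m topology"
  atlas :: "('m, 'a) chart set"

definition charts_at :: "('m, 'a) manifold \<Rightarrow> 'm \<Rightarrow> ('m, 'a) chart set" where
  "charts_at M x = {c \<in> atlas M. x \<in> fst c}"

definition chart_inv :: "('m, 'a) chart \<Rightarrow> 'a \<Rightarrow> 'm" where
  "chart_inv c = inv_into (fst c) (snd c)"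

definition is_chart :: "'m topology \<Rightarrow> ('m, 'a::euclidean_space) chart \<Rightarrow> bool" where
  "is_chart X c \<longleftrightarrow>
     openin X (fst c) \<and> open (snd c ` fst c) \<and>
     homeomorphic_map (subtopology X (fst c)) (top_of_set (snd c ` fst c)) (snd c)"

text \<open>A (Hausdorff, second countable, boundaryless) smooth manifold of dimension \<open>DIM('a)\<close>.
  The atlas need not be maximal; it stands for the smooth structure it generates.\<close>

definition smooth_manifold :: "('m, 'a::euclidean_space) manifold \<Rightarrow> bool" where
  "smooth_manifold M \<longleftrightarrow>
     Hausdorff_space (topo M) \<and>
     (\<exists>\<B>. countable \<B> \<and> openin (topo M) = arbitrary union_of (\<lambda>V. V \<in> \<B>)) \<and>
     (\<forall>c\<in>atlas M. is_chart (topo M) c) \<and>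
     (\<Union>c\<in>atlas M. fst c) = topspace (topo M) \<and>
     (\<forall>c\<in>atlas M. \<forall>d\<in>atlas M. smooth_on (snd c ` (fst c \<inter> fst d)) (snd d \<circ> chart_inv c))"

text \<open>Smoothness of a vector-valued function on an open subset \<open>W\<close> of \<open>M\<close>.\<close>

definition smooth_fun_on ::
  "('m, 'a::euclidean_space) manifold \<Rightarrow> 'm set \<Rightarrow> ('m \<Rightarrow> 'b::euclidean_space) \<Rightarrow> bool" where
  "smooth_fun_on M W h \<longleftrightarrow> (\<forall>c\<in>atlas M. smooth_on (snd c ` (fst c \<inter> W)) (h \<circ> chart_inv c))"

definition smooth_map ::
  "('m, 'a::euclidean_space) manifold \<Rightarrow> ('k, 'b::euclidean_space) manifold \<Rightarrow> ('m \<Rightarrow> 'k) \<Rightarrow> bool" where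
  "smooth_map M N f \<longleftrightarrow>
     continuous_map (topo M) (topo N) f \<and>
     (\<forall>d\<in>atlas N. smooth_fun_on M (topspace (topo M) \<inter> f -` fst d) (snd d \<circ> f))"


section \<open>Tangent spaces\<close>

text \<open>Pointwise scalar multiplication, so that families of vectors form a real vector space.\<close>

instantiation "fun" :: (type, real_vector) real_vector
begin

definition scaleR_fun :: "real \<Rightarrow> ('a \<Rightarrow> 'b) \<Rightarrow> 'a \<Rightarrow> 'b" where
  "scaleR_fun t v = (\<lambda>i. t *\<^sub>R v i)"

instance
  by standard (simp_all add: scaleR_fun_def plus_fun_def scaleR_add_right scaleR_add_left)

end

text \<open>A tangent vector at \<open>x\<close> is the family of its coordinate vectors in all charts around \<open>x\<close>: the
  members of the family are related by the derivatives of the transition maps.  (This is the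
  equivalence class of the triples (chart, point, vector).)  At charts that do not contain \<open>x\<close>
  the family is \<open>0\<close> by convention, which makes the family unique.\<close>

type_synonym ('m, 'a) tvec = "('m, 'a) chart \<Rightarrow> 'a"

definition tangent_space :: "('m, 'a::euclidean_space) manifold \<Rightarrow> 'm \<Rightarrow> ('m, 'a) tvec set" where
  "tangent_space M x =
     {v. (\<forall>c\<in>charts_at M x. \<forall>d\<in>charts_at M x.
            v d = frechet_derivative (snd d \<circ> chart_inv c) (at (snd c x)) (v c)) \<and>
         (\<forall>c. c \<notin> charts_at M x \<longrightarrow> v c = 0)}"

text \<open>The tangent vector at \<open>x\<close> whose coordinate vector in the chart \<open>c\<close> is \<open>u\<close>.\<close>

definition coord_vector ::
  "('m, 'a::euclidean_space) manifold \<Rightarrow> ('m, 'a) chart \<Rightarrow> 'm \<Rightarrow> 'a \<Rightarrow> ('m, 'a) tvec" where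
  "coord_vector M c x u =
     (\<lambda>d. if d \<in> charts_at M x
          then frechet_derivative (snd d \<circ> chart_inv c) (at (snd c x)) u else 0)"

text \<open>The differential of \<open>f\<close> at \<open>x\<close>; by the chain rule it does not depend on the choice of \<open>c\<close>.\<close>

definition differential ::
  "('m, 'a::euclidean_space) manifold \<Rightarrow> ('k, 'b::euclidean_space) manifold \<Rightarrow> ('m \<Rightarrow> 'k) \<Rightarrow> 'm
     \<Rightarrow> ('m, 'a) tvec \<Rightarrow> ('k, 'b) tvec" where
  "differential M N f x v =
     (let c = (SOME c. c \<in> charts_at M x) in
      (\<lambda>d. if d \<in> charts_at N (f x)
           then frechet_derivative (snd d \<circ> f \<circ> chart_inv c) (at (snd c x)) (v c) else 0))"

definition immersion ::
  "('m, 'a::euclidean_space) manifold \<Rightarrow> ('k, 'b::euclidean_space) manifold \<Rightarrow> ('m \<Rightarrow> 'k) \<Rightarrow> bool" where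
  "immersion M N f \<longleftrightarrow>
     smooth_map M N f \<and>
     (\<forall>x\<in>topspace (topo M). inj_on (differential M N f x) (tangent_space M x))"


section \<open>Metallic Riemannian manifolds\<close>

type_synonym ('m, 'a) metric_field = "'m \<Rightarrow> ('m, 'a) tvec \<Rightarrow> ('m, 'a) tvec \<Rightarrow> real"
type_synonym ('m, 'a) endo_field = "'m \<Rightarrow> ('m, 'a) tvec \<Rightarrow> ('m, 'a) tvec"

definition linear_on_subspace :: "'v::real_vector set \<Rightarrow> ('v \<Rightarrow> 'w::real_vector) \<Rightarrow> bool" where
  "linear_on_subspace V h \<longleftrightarrow>
     (\<forall>u\<in>V. \<forall>v\<in>V. h (u + v) = h u + h v) \<and> (\<forall>t. \<forall>v\<in>V. h (t *\<^sub>R v) = t *\<^sub>R h v)"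

text \<open>Smoothness of tensor fields is smoothness of their components in every chart.  Values of the
  tensor fields outside the tangent spaces are irrelevant.\<close>

definition riemannian_metric ::
  "('m, 'a::euclidean_space) manifold \<Rightarrow> ('m, 'a) metric_field \<Rightarrow> bool" where
  "riemannian_metric M g \<longleftrightarrow>
     (\<forall>x\<in>topspace (topo M).
        (\<forall>X\<in>tangent_space M x. linear_on_subspace (tangent_space M x) (g x X)) \<and>
        (\<forall>X\<in>tangent_space M x. \<forall>Y\<in>tangent_space M x. g x X Y = g x Y X) \<and>
        (\<forall>X\<in>tangent_space M x. X \<noteq> 0 \<longrightarrow> g x X X > 0)) \<and>
     (\<forall>c\<in>atlas M. \<forall>u v.
        smooth_fun_on M (fst c) (\<lambda>x. g x (coord_vector M c x u) (coord_vector M c x v)))"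

definition tensor_field_1_1 ::
  "('m, 'a::euclidean_space) manifold \<Rightarrow> ('m, 'a) endo_field \<Rightarrow> bool" where
  "tensor_field_1_1 M J \<longleftrightarrow>
     (\<forall>x\<in>topspace (topo M).
        J x ` tangent_space M x \<subseteq> tangent_space M x \<and>
        linear_on_subspace (tangent_space M x) (J x)) \<and>
     (\<forall>c\<in>atlas M. \<forall>u. smooth_fun_on M (fst c) (\<lambda>x. J x (coord_vector M c x u) c))"

definition metallic_riemannian_manifold ::
  "('m, 'a::euclidean_space) manifold \<Rightarrow> ('m, 'a) endo_field \<Rightarrow> ('m, 'a) metric_field
     \<Rightarrow> nat \<Rightarrow> nat \<Rightarrow> bool" where
  "metallic_riemannian_manifold M J g p q \<longleftrightarrow>
     smooth_manifold M \<and> riemannian_metric M g \<and> tensor_field_1_1 M J \<and> p > 0 \<and> q > 0 \<and>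
     (\<forall>x\<in>topspace (topo M). \<forall>X\<in>tangent_space M x.
        J x (J x X) = real p *\<^sub>R J x X + real q *\<^sub>R X) \<and>
     (\<forall>x\<in>topspace (topo M). \<forall>X\<in>tangent_space M x. \<forall>Y\<in>tangent_space M x.
        g x (J x X) Y = g x X (J x Y))"


section \<open>Isometrically immersed submanifolds and the induced structure\<close>

definition isometric_immersion ::
  "('m, 'a::euclidean_space) manifold \<Rightarrow> ('m, 'a) metric_field
     \<Rightarrow> ('k, 'b::euclidean_space) manifold \<Rightarrow> ('k, 'b) metric_field \<Rightarrow> ('m \<Rightarrow> 'k) \<Rightarrow> bool" where
  "isometric_immersion M gM N g f \<longleftrightarrow>
     immersion M N f \<and>
     (\<forall>x\<in>topspace (topo M). \<forall>X\<in>tangent_space M x. \<forall>Y\<in>tangent_space M x.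
        gM x X Y = g (f x) (differential M N f x X) (differential M N f x Y))"

text \<open>\<open>T\<^sub>xM\<close>, regarded as a subspace of the tangent space of the ambient manifold at \<open>f x\<close>.\<close>

definition immersed_tangent_space ::
  "('m, 'a::euclidean_space) manifold \<Rightarrow> ('k, 'b::euclidean_space) manifold \<Rightarrow> ('m \<Rightarrow> 'k)
     \<Rightarrow> 'm \<Rightarrow> ('k, 'b) tvec set" where
  "immersed_tangent_space M N f x = differential M N f x ` tangent_space M x"

definition normal_space ::
  "('m, 'a::euclidean_space) manifold \<Rightarrow> ('k, 'b::euclidean_space) manifold \<Rightarrow> ('k, 'b) metric_field
     \<Rightarrow> ('m \<Rightarrow> 'k) \<Rightarrow> 'm \<Rightarrow> ('k, 'b) tvec set" where
  "normal_space M N g f x =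
     {V \<in> tangent_space N (f x). \<forall>W\<in>immersed_tangent_space M N f x. g (f x) V W = 0}"

text \<open>A smooth orthonormal frame \<open>\<nu> 1, \<dots>, \<nu> r\<close> of the normal bundle over an open subset \<open>U\<close> of \<open>M\<close>;
  the components of the \<open>\<nu> \<alpha>\<close> in a chart \<open>d\<close> of the ambient manifold are functions on an open
  subset of \<open>M\<close>.\<close>

definition orthonormal_normal_frame ::
  "('m, 'a::euclidean_space) manifold \<Rightarrow> ('k, 'b::euclidean_space) manifold \<Rightarrow> ('k, 'b) metric_field
     \<Rightarrow> ('m \<Rightarrow> 'k) \<Rightarrow> 'm set \<Rightarrow> nat \<Rightarrow> (nat \<Rightarrow> 'm \<Rightarrow> ('k, 'b) tvec) \<Rightarrow> bool" where
  "orthonormal_normal_frame M N g f U r \<nu> \<longleftrightarrow>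
     (\<forall>x\<in>U.
        span ((\<lambda>\<alpha>. \<nu> \<alpha> x) ` {1..r}) = normal_space M N g f x \<and>
        (\<forall>\<alpha>\<in>{1..r}. \<forall>\<beta>\<in>{1..r}. g (f x) (\<nu> \<alpha> x) (\<nu> \<beta> x) = (if \<alpha> = \<beta> then 1 else 0))) \<and>
     (\<forall>\<alpha>\<in>{1..r}. \<forall>d\<in>atlas N. smooth_fun_on M (U \<inter> f -` fst d) (\<lambda>x. \<nu> \<alpha> x d))"

text \<open>The induced structure on \<open>U\<close>; together with the induced metric, \<open>T\<close>, \<open>\<eta>\<close>, \<open>\<xi>\<close>, \<open>a\<close> are
  determined by these equations, since the tangent space of the ambient manifold is the direct sum
  of the tangent and the normal space of \<open>M\<close> and the differential of \<open>f\<close> is injective.\<close>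

definition induced_structure ::
  "('m, 'a::euclidean_space) manifold \<Rightarrow> ('k, 'b::euclidean_space) manifold \<Rightarrow> ('k, 'b) endo_field
     \<Rightarrow> ('m \<Rightarrow> 'k) \<Rightarrow> 'm set \<Rightarrow> nat \<Rightarrow> (nat \<Rightarrow> 'm \<Rightarrow> ('k, 'b) tvec) \<Rightarrow> ('m, 'a) endo_field
     \<Rightarrow> (nat \<Rightarrow> 'm \<Rightarrow> ('m, 'a) tvec \<Rightarrow> real) \<Rightarrow> (nat \<Rightarrow> 'm \<Rightarrow> ('m, 'a) tvec)
     \<Rightarrow> (nat \<Rightarrow> nat \<Rightarrow> 'm \<Rightarrow> real) \<Rightarrow> bool" where
  "induced_structure M N J f U r \<nu> T \<eta> \<xi> a \<longleftrightarrow>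
     (\<forall>x\<in>U.
        (\<forall>X\<in>tangent_space M x.
           T x X \<in> tangent_space M x \<and>
           J (f x) (differential M N f x X) =
             differential M N f x (T x X) + (\<Sum>\<alpha>=1..r. \<eta> \<alpha> x X *\<^sub>R \<nu> \<alpha> x)) \<and>
        (\<forall>\<alpha>\<in>{1..r}.
           \<xi> \<alpha> x \<in> tangent_space M x \<and>
           J (f x) (\<nu> \<alpha> x) =
             differential M N f x (\<xi> \<alpha> x) + (\<Sum>\<beta>=1..r. a \<alpha> \<beta> x *\<^sub>R \<nu> \<beta> x)))"


section \<open>Slant submanifolds\<close>

definition orthogonal_projection ::
  "('v::real_vector \<Rightarrow> 'v \<Rightarrow> real) \<Rightarrow> 'v set \<Rightarrow> 'v \<Rightarrow> 'v" where
  "orthogonal_projection b W v = (THE w. w \<in> W \<and> (\<forall>u\<in>W. b (v - w) u = 0))"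

text \<open>The angle in \<open>[0, \<pi>/2]\<close> between a nonzero vector and a subspace.\<close>

definition angle_to_subspace ::
  "('v::real_vector \<Rightarrow> 'v \<Rightarrow> real) \<Rightarrow> 'v set \<Rightarrow> 'v \<Rightarrow> real" where
  "angle_to_subspace b W v =
     (let w = orthogonal_projection b W v in arccos (sqrt (b w w) / sqrt (b v v)))"

definition slant_submanifold ::
  "('m, 'a::euclidean_space) manifold \<Rightarrow> ('k, 'b::euclidean_space) manifold \<Rightarrow> ('k, 'b) endo_field
     \<Rightarrow> ('k, 'b) metric_field \<Rightarrow> ('m \<Rightarrow> 'k) \<Rightarrow> real \<Rightarrow> bool" where
  "slant_submanifold M N J g f \<theta> \<longleftrightarrow>
     0 \<le> \<theta> \<and> \<theta> \<le> pi / 2 \<and>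
     (\<forall>x\<in>topspace (topo M). \<forall>X\<in>tangent_space M x. X \<noteq> 0 \<longrightarrow>
        angle_to_subspace (g (f x)) (immersed_tangent_space M N f x)
          (J (f x) (differential M N f x X)) = \<theta>)"

definition invariant_submanifold ::
  "('m, 'a::euclidean_space) manifold \<Rightarrow> ('k, 'b::euclidean_space) manifold \<Rightarrow> ('k, 'b) endo_field
     \<Rightarrow> ('m \<Rightarrow> 'k) \<Rightarrow> bool" where
  "invariant_submanifold M N J f \<longleftrightarrow>
     (\<forall>x\<in>topspace (topo M).
        J (f x) ` immersed_tangent_space M N f x \<subseteq> immersed_tangent_space M N f x)"

definition anti_invariant_submanifold ::
  "('m, 'a::euclidean_space) manifold \<Rightarrow> ('k, 'b::euclidean_space) manifold \<Rightarrow> ('k, 'b) endo_field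
     \<Rightarrow> ('k, 'b) metric_field \<Rightarrow> ('m \<Rightarrow> 'k) \<Rightarrow> bool" where
  "anti_invariant_submanifold M N J g f \<longleftrightarrow>
     (\<forall>x\<in>topspace (topo M).
        J (f x) ` immersed_tangent_space M N f x \<subseteq> normal_space M N g f x)"

definition proper_slant_submanifold ::
  "('m, 'a::euclidean_space) manifold \<Rightarrow> ('k, 'b::euclidean_space) manifold \<Rightarrow> ('k, 'b) endo_field
     \<Rightarrow> ('k, 'b) metric_field \<Rightarrow> ('m \<Rightarrow> 'k) \<Rightarrow> real \<Rightarrow> bool" where
  "proper_slant_submanifold M N J g f \<theta> \<longleftrightarrow>
     slant_submanifold M N J g f \<theta> \<and>
     \<not> invariant_submanifold M N J f \<and> \<not> anti_invariant_submanifold M N J g f"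

end

theory Submission
  imports Defs
begin

text \<open>
  The identity is pointwise linear algebra on \<open>T\<^sub>xM\<close>.  Self-adjointness of \<open>J\<close> makes \<open>T\<close> self-adjoint
  and gives \<open>\<eta>\<^sub>\<alpha>(X) = g(X, \<xi>\<^sub>\<alpha>)\<close>; hence \<open>g(T\<^sup>2X, X) = \<parallel>TX\<parallel>\<^sup>2\<close>, while \<open>\<Sum>\<^sub>\<alpha> \<eta>\<^sub>\<alpha>(X) g(\<xi>\<^sub>\<alpha>, X)\<close> is
  the squared length of the normal part of \<open>JX\<close>.  Constancy of the angle says
  \<open>\<parallel>TX\<parallel>\<^sup>2 = cos\<^sup>2\<theta> \<parallel>JX\<parallel>\<^sup>2\<close>, and by Pythagoras this means that the self-adjoint operator
  \<open>S = sin\<^sup>2\<theta> T\<^sup>2 - cos\<^sup>2\<theta> \<Sum>\<^sub>\<alpha> \<eta>\<^sub>\<alpha> \<otimes> \<xi>\<^sub>\<alpha>\<close> has vanishing quadratic form.  By polarization \<open>S = 0\<close>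
  (\<open>slant_square_identity\<close>), and one divides by \<open>sin\<^sup>2\<theta>\<close>.

  The division is legitimate because \<open>sin \<theta> = 0\<close> forces \<open>\<theta> = 0\<close>, so that every \<open>JX\<close> equals its
  orthogonal projection to the tangent space and \<open>M\<close> is invariant
  (\<open>slant_angle_zero_imp_invariant\<close>).  As an angle is defined through the orthogonal projection, that
  argument needs the projection to exist, hence finite dimension of the tangent spaces.

  The geometric input is that the differential of a smooth map is a linear map between tangent
  spaces (\<open>differential_in_tangent_space\<close>, \<open>linear_differential\<close>).  Since tangent vectors are
  families of coordinate vectors, this is the chain rule applied to changes of charts.
\<close>

section \<open>Inner products on a subspace\<close>

locale inner_product_on =
  fixes V :: "'v::real_vector set" and b :: "'v \<Rightarrow> 'v \<Rightarrow> real"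
  assumes subspace: "subspace V"
    and linear: "u \<in> V \<Longrightarrow> linear_on_subspace V (b u)"
    and sym: "u \<in> V \<Longrightarrow> v \<in> V \<Longrightarrow> b u v = b v u"
    and pos: "v \<in> V \<Longrightarrow> v \<noteq> 0 \<Longrightarrow> b v v > 0"
begin

lemmas closed = subspace_0[OF subspace] subspace_add[OF subspace] subspace_diff[OF subspace]
  subspace_scale[OF subspace] subspace_sum[OF subspace]

lemma add_right: "u \<in> V \<Longrightarrow> v \<in> V \<Longrightarrow> w \<in> V \<Longrightarrow> b u (v + w) = b u v + b u w"
  using linear unfolding linear_on_subspace_def by blast

lemma scale_right: "u \<in> V \<Longrightarrow> v \<in> V \<Longrightarrow> b u (t *\<^sub>R v) = t * b u v"
  using linear unfolding linear_on_subspace_def by (metis real_scaleR_def)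

lemma add_left: "u \<in> V \<Longrightarrow> v \<in> V \<Longrightarrow> w \<in> V \<Longrightarrow> b (v + w) u = b v u + b w u"
  using add_right sym closed by metis

lemma scale_left: "u \<in> V \<Longrightarrow> v \<in> V \<Longrightarrow> b (t *\<^sub>R v) u = t * b v u"
  using scale_right sym closed by metis

lemma diff_left: "u \<in> V \<Longrightarrow> v \<in> V \<Longrightarrow> w \<in> V \<Longrightarrow> b (v - w) u = b v u - b w u"
  using add_left[of u "v - w" w] closed by simp

lemma zero_right: "u \<in> V \<Longrightarrow> b u 0 = 0"
  using scale_right[of u u 0] by simp

lemma zero_left: "u \<in> V \<Longrightarrow> b 0 u = 0"
  using scale_left[of u u 0] by simp

lemma sum_right: "u \<in> V \<Longrightarrow> (\<And>i. i \<in> I \<Longrightarrow> h i \<in> V) \<Longrightarrow> b u (\<Sum>i\<in>I. h i) = (\<Sum>i\<in>I. b u (h i))"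
  by (induction I rule: infinite_finite_induct) (simp_all add: zero_right add_right closed)

lemma sum_left: "u \<in> V \<Longrightarrow> (\<And>i. i \<in> I \<Longrightarrow> h i \<in> V) \<Longrightarrow> b (\<Sum>i\<in>I. h i) u = (\<Sum>i\<in>I. b (h i) u)"
  by (induction I rule: infinite_finite_induct) (simp_all add: zero_left add_left closed)

lemma lincomb_right:
  assumes "u \<in> V" "\<And>i. i \<in> I \<Longrightarrow> h i \<in> V"
  shows "b u (\<Sum>i\<in>I. k i *\<^sub>R h i) = (\<Sum>i\<in>I. k i * b u (h i))"
  using assms by (subst sum_right) (auto simp: scale_right closed intro!: sum.cong)

lemma lincomb_left:
  assumes "u \<in> V" "\<And>i. i \<in> I \<Longrightarrow> h i \<in> V"
  shows "b (\<Sum>i\<in>I. k i *\<^sub>R h i) u = (\<Sum>i\<in>I. k i * b (h i) u)"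
  using assms by (subst sum_left) (auto simp: scale_left closed intro!: sum.cong)

lemma nonneg: "v \<in> V \<Longrightarrow> b v v \<ge> 0"
  using pos[of v] zero_left[of 0] closed(1) by (cases "v = 0") auto

lemma eq_zero: "v \<in> V \<Longrightarrow> b v v = 0 \<Longrightarrow> v = 0"
  using pos by fastforce

text \<open>Polarization: moving \<open>S\<close> to the other argument and expanding there turns
  \<open>b(S(X + Y), X + Y) = 0\<close> into \<open>2 b(SX, Y) = 0\<close>; one then takes \<open>Y = SX\<close>.\<close>

lemma self_adjoint_eq_zero:
  assumes S: "\<And>v. v \<in> V \<Longrightarrow> S v \<in> V"
    and adj: "\<And>u v. u \<in> V \<Longrightarrow> v \<in> V \<Longrightarrow> b (S u) v = b u (S v)"
    and quad: "\<And>v. v \<in> V \<Longrightarrow> b (S v) v = 0"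
    and X: "X \<in> V"
  shows "S X = 0"
proof -
  define Y where "Y = S X"
  have Y: "Y \<in> V" using S X Y_def by simp
  have "0 = b (S (X + Y)) (X + Y)" using quad X Y closed by simp
  also have "\<dots> = b (S (X + Y)) X + b (S (X + Y)) Y"
    using X Y S closed by (intro add_right) auto
  also have "\<dots> = b (X + Y) (S X) + b (X + Y) (S Y)" using adj X Y closed by simp
  also have "\<dots> = b X (S X) + b Y (S X) + (b X (S Y) + b Y (S Y))"
    using X Y S by (simp add: add_left)
  also have "\<dots> = 2 * b Y Y"
    using adj[OF X Y] adj[OF X X] adj[OF Y Y] quad[OF X] quad[OF Y]
    by (simp add: Y_def[symmetric])
  finally show ?thesis using eq_zero Y Y_def by simp
qed

text \<open>One Gram--Schmidt step: the new spanning vector is first made orthogonal to the old span.\<close>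

lemma projection_exists:
  assumes "finite B" "B \<subseteq> V" "v \<in> V"
  shows "\<exists>w\<in>span B. \<forall>u\<in>span B. b (v - w) u = 0"
  using assms
proof (induction B arbitrary: v rule: finite_induct)
  case empty
  then show ?case using closed zero_right by simp
next
  case (insert s B)
  then have BV: "B \<subseteq> V" and sV: "s \<in> V" by auto
  have spV: "span B \<subseteq> V" using BV subspace span_minimal by blast
  obtain s0 where s0: "s0 \<in> span B" "\<And>u. u \<in> span B \<Longrightarrow> b (s - s0) u = 0"
    using insert.IH[OF BV sV] by blast
  obtain w0 where w0: "w0 \<in> span B" "\<And>u. u \<in> span B \<Longrightarrow> b (v - w0) u = 0"
    using insert.IH[OF BV insert.prems(2)] by blast
  define e where "e = s - s0"
  define t where "t = b (v - w0) e / b e e"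
  define w where "w = w0 + t *\<^sub>R e"
  have V: "s0 \<in> V" "w0 \<in> V" "e \<in> V" "v \<in> V" "v - w0 \<in> V" "t *\<^sub>R e \<in> V" "w \<in> V" "v - w \<in> V"
    using s0 w0 spV sV insert.prems closed unfolding e_def w_def by (auto simp: subset_iff)
  have vw: "v - w = (v - w0) - t *\<^sub>R e" by (simp add: w_def)
  have val: "b (v - w) u = b (v - w0) u - t * b e u" if "u \<in> V" for u
    unfolding vw using V that by (simp add: diff_left scale_left)
  have orth: "b (v - w) u = 0" if "u \<in> span B" for u
    using val[of u] s0(2) w0(2) that spV by (auto simp: e_def)
  have orth_e: "b (v - w) e = 0"
    using val[OF V(3)] V zero_right[OF V(8)] eq_zero[of e] by (cases "e = 0") (auto simp: t_def)
  have w: "w \<in> span (insert s B)"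
    unfolding w_def e_def
    by (meson insertI1 s0(1) span_add span_base span_diff span_mono span_scale subsetD
        subset_insertI w0(1))
  have "b (v - w) u = 0" if u: "u \<in> span (insert s B)" for u
  proof -
    obtain k where k: "u - k *\<^sub>R s \<in> span B" using u unfolding span_insert by blast
    define u1 where "u1 = (u - k *\<^sub>R s) + k *\<^sub>R s0"
    have u1: "u1 \<in> span B" using k s0(1) span_add span_scale unfolding u1_def by blast
    have ueq: "u = u1 + k *\<^sub>R e" by (simp add: u1_def e_def algebra_simps)
    show ?thesis unfolding ueq using u1 spV V orth[OF u1] orth_e closed
      by (subst add_right) (auto simp: scale_right)
  qed
  then show ?case using w by blast
qed

lemma orthogonal_projection_eqI:
  assumes W: "subspace W" "W \<subseteq> V" and v: "v \<in> V"
    and w: "w \<in> W" and orth: "\<And>u. u \<in> W \<Longrightarrow> b (v - w) u = 0"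
  shows "orthogonal_projection b W v = w"
  unfolding orthogonal_projection_def
proof (rule the_equality)
  show "w \<in> W \<and> (\<forall>u\<in>W. b (v - w) u = 0)" using w orth by blast
  fix w' assume w': "w' \<in> W \<and> (\<forall>u\<in>W. b (v - w') u = 0)"
  then have "w' - w \<in> W" using w W subspace_diff by blast
  then have "b (v - w) (w' - w) = 0" "b (v - w') (w' - w) = 0" using orth w' by auto
  moreover have "b (v - w) (w' - w) - b (v - w') (w' - w) = b (w' - w) (w' - w)"
  proof -
    have V: "w \<in> V" "w' \<in> V" "v \<in> V" "w' - w \<in> V" using w w' W v closed(3) by blast+
    show ?thesis using V by (simp add: diff_left)
  qed
  ultimately show "w' = w" using eq_zero[of "w' - w"] w w' W closed(3) by (metis eq_iff_diff_eq_0 subsetD)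
qed

lemma pythagoras:
  assumes "w \<in> V" "m \<in> V" "b m w = 0"
  shows "b (w + m) (w + m) = b w w + b m m"
  using assms sym[of w m] closed by (simp add: add_left add_right)

text \<open>The quotient of lengths lies in \<open>[0, 1]\<close> by Pythagoras, so the cosine undoes \<open>arccos\<close>.\<close>

lemma cos_angle_to_subspace:
  assumes W: "subspace W" "W \<subseteq> V" and v: "v \<in> V" "v \<noteq> 0"
    and w: "w \<in> W" and orth: "\<And>u. u \<in> W \<Longrightarrow> b (v - w) u = 0"
  shows "b w w = (cos (angle_to_subspace b W v))\<^sup>2 * b v v"
proof -
  have V: "w \<in> V" "v - w \<in> V" using w W v closed by auto
  have "b v v = b w w + b (v - w) (v - w)"
    using pythagoras[OF V] orth[OF w] by simp
  then have le: "b w w \<le> b v v" using nonneg[OF V(2)] by simp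
  have vv: "b v v > 0" using pos v by blast
  have "0 \<le> sqrt (b w w) / sqrt (b v v)" "sqrt (b w w) / sqrt (b v v) \<le> 1"
    using le vv nonneg[OF V(1)] by auto
  then have "cos (angle_to_subspace b W v) = sqrt (b w w) / sqrt (b v v)"
    using orthogonal_projection_eqI[OF W v(1) w orth]
    by (simp add: angle_to_subspace_def Let_def cos_arccos)
  then show ?thesis using vv nonneg[OF V(1)] by (simp add: power_divide)
qed

lemma in_subspace_if_angle_zero:
  assumes B: "finite B" "W = span B" "W \<subseteq> V" and v: "v \<in> V" "v \<noteq> 0"
    and angle: "angle_to_subspace b W v = 0"
  shows "v \<in> W"
proof -
  have "B \<subseteq> V" using B span_superset by blast
  then obtain w where w: "w \<in> W" "\<And>u. u \<in> W \<Longrightarrow> b (v - w) u = 0"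
    using projection_exists[OF B(1) _ v(1)] B(2) by blast
  have V: "w \<in> V" "v - w \<in> V" using w B v closed by auto
  have "b w w = b v v"
    using cos_angle_to_subspace[OF _ B(3) v w] angle B(2) by simp
  moreover have "b v v = b w w + b (v - w) (v - w)"
    using pythagoras[OF V] w by simp
  ultimately have "v - w = 0" using eq_zero[OF V(2)] by simp
  then show ?thesis using w by simp
qed

end

lemma linear_on_subspace_zero:
  "subspace V \<Longrightarrow> linear_on_subspace V h \<Longrightarrow> h 0 = 0"
  unfolding linear_on_subspace_def using subspace_0 scaleR_zero_left by metis

lemma subspace_linear_image:
  assumes V: "subspace V" and h: "linear_on_subspace V h"
  shows "subspace (h ` V)"
  unfolding subspace_def
proof (intro conjI ballI allI)
  show "0 \<in> h ` V" using linear_on_subspace_zero[OF V h] subspace_0[OF V] by force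
  show "u + v \<in> h ` V" if "u \<in> h ` V" "v \<in> h ` V" for u v
  proof -
    obtain x y where xy: "x \<in> V" "y \<in> V" "u = h x" "v = h y" using \<open>u \<in> h ` V\<close> \<open>v \<in> h ` V\<close> by blast
    then have "u + v = h (x + y)" using h unfolding linear_on_subspace_def by simp
    then show ?thesis using subspace_add[OF V xy(1,2)] by blast
  qed
  show "t *\<^sub>R u \<in> h ` V" if "u \<in> h ` V" for t u
  proof -
    obtain x where x: "x \<in> V" "u = h x" using \<open>u \<in> h ` V\<close> by blast
    then have "t *\<^sub>R u = h (t *\<^sub>R x)" using h unfolding linear_on_subspace_def by simp
    then show ?thesis using subspace_scale[OF V x(1)] by blast
  qed
qed

lemma linear_image_span:
  assumes h: "linear_on_subspace (span B) h"
  shows "h ` span B = span (h ` B)"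
proof
  have "v \<in> span B \<and> h v \<in> span (h ` B)" if "v \<in> span B" for v
    using that
  proof (induction rule: span_induct_alt)
    case base
    then show ?case using linear_on_subspace_zero[OF _ h] by (simp add: span_0)
  next
    case (step t x y)
    then have x: "x \<in> span B" "t *\<^sub>R x \<in> span B" by (simp_all add: span_base span_scale)
    have "h (t *\<^sub>R x + y) = t *\<^sub>R h x + h y"
      using h x step unfolding linear_on_subspace_def by simp
    then show ?case using step by (simp add: span_add span_scale span_base)
  qed
  then show "h ` span B \<subseteq> span (h ` B)" by blast
  show "span (h ` B) \<subseteq> h ` span B"
    using subspace_linear_image[OF subspace_span h] span_superset
    by (intro span_minimal) (auto intro: span_base)
qed

lemma finitely_spanned_if_injects:
  fixes e :: "'v::real_vector \<Rightarrow> 'a::euclidean_space"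
  assumes V: "subspace V" and e: "linear_on_subspace V e" and inj: "inj_on e V"
  shows "\<exists>B. finite B \<and> span B = V"
proof -
  have "subspace (e ` V)" by (rule subspace_linear_image[OF V e])
  then have span: "span (e ` V) = e ` V" by simp
  obtain C where C: "C \<subseteq> e ` V" "independent C" "e ` V \<subseteq> span C"
    by (rule basis_exists)
  have C_span: "span C = e ` V" using span_mono[OF C(1)] C(3) by (simp add: span)
  have fin: "finite C" using C(2) independent_bound by blast
  define B where "B = inv_into V e ` C"
  have BV: "B \<subseteq> V" unfolding B_def
  proof clarify
    fix y assume "y \<in> C"
    then show "inv_into V e y \<in> V" using C(1) by (intro inv_into_into) blast
  qed
  then have sub: "span B \<subseteq> V" using V span_minimal by blast
  have "linear_on_subspace (span B) e"
    using e sub unfolding linear_on_subspace_def by blast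
  then have "e ` span B = span (e ` B)" by (rule linear_image_span)
  also have "e ` B = C" unfolding B_def by (rule image_inv_into_cancel[OF refl C(1)])
  finally have "e ` span B = e ` V" using C_span by simp
  then have "span B = V" using inj sub by (simp add: inj_on_image_eq_iff)
  moreover have "finite B" using fin by (simp add: B_def)
  ultimately show ?thesis by (intro exI conjI)
qed

section \<open>The slant identity in a single tangent space\<close>

text \<open>Here \<open>E\<close> and \<open>V\<close> are the tangent spaces of the ambient manifold and of the submanifold at one
  point, and \<open>D\<close> is the differential of the immersion.  For \<open>\<theta> = \<pi>/2\<close> the right-hand side is \<open>0\<close>,
  since then \<open>tan \<theta> = sin \<theta> / 0 = 0\<close> and \<open>1 / 0 = 0\<close>; this is the correct value of the squared
  cotangent.\<close>

lemma slant_square_identity: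
  fixes J :: "'e::real_vector \<Rightarrow> 'e" and D :: "'v::real_vector \<Rightarrow> 'e" and r :: nat
  assumes "inner_product_on E g" "inner_product_on V h"
    and D: "linear_on_subspace V D" "\<And>X. X \<in> V \<Longrightarrow> D X \<in> E"
    and iso: "\<And>X Y. X \<in> V \<Longrightarrow> Y \<in> V \<Longrightarrow> h X Y = g (D X) (D Y)"
    and J_in: "\<And>u. u \<in> E \<Longrightarrow> J u \<in> E"
    and J_inj: "\<And>u. u \<in> E \<Longrightarrow> J u = 0 \<Longrightarrow> u = 0"
    and J_adj: "\<And>u v. u \<in> E \<Longrightarrow> v \<in> E \<Longrightarrow> g (J u) v = g u (J v)"
    and \<nu>: "\<And>\<alpha>. \<alpha> \<in> {1..r} \<Longrightarrow> \<nu> \<alpha> \<in> E"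
    and \<nu>_normal: "\<And>\<alpha> X. \<alpha> \<in> {1..r} \<Longrightarrow> X \<in> V \<Longrightarrow> g (\<nu> \<alpha>) (D X) = 0"
    and \<nu>_orth: "\<And>\<alpha> \<beta>. \<alpha> \<in> {1..r} \<Longrightarrow> \<beta> \<in> {1..r} \<Longrightarrow> g (\<nu> \<alpha>) (\<nu> \<beta>) = (if \<alpha> = \<beta> then 1 else 0)"
    and T: "\<And>X. X \<in> V \<Longrightarrow> T X \<in> V"
    and JD: "\<And>X. X \<in> V \<Longrightarrow> J (D X) = D (T X) + (\<Sum>\<alpha>=1..r. \<eta> \<alpha> X *\<^sub>R \<nu> \<alpha>)"
    and \<xi>: "\<And>\<alpha>. \<alpha> \<in> {1..r} \<Longrightarrow> \<xi> \<alpha> \<in> V"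
    and J\<nu>: "\<And>\<alpha>. \<alpha> \<in> {1..r} \<Longrightarrow> J (\<nu> \<alpha>) = D (\<xi> \<alpha>) + (\<Sum>\<beta>=1..r. a \<alpha> \<beta> *\<^sub>R \<nu> \<beta>)"
    and angle: "\<And>X. X \<in> V \<Longrightarrow> X \<noteq> 0 \<Longrightarrow> angle_to_subspace g (D ` V) (J (D X)) = \<theta>"
    and sin: "sin \<theta> \<noteq> 0"
    and X: "X \<in> V"
  shows "T (T X) = (1 / (tan \<theta>)\<^sup>2) *\<^sub>R (\<Sum>\<alpha>=1..r. \<eta> \<alpha> X *\<^sub>R \<xi> \<alpha>)"
proof -
  interpret E: inner_product_on E g by fact
  interpret V: inner_product_on V h by fact
  define N where "N X = (\<Sum>\<alpha>=1..r. \<eta> \<alpha> X *\<^sub>R \<nu> \<alpha>)" for X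
  define P where "P X = (\<Sum>\<alpha>=1..r. \<eta> \<alpha> X *\<^sub>R \<xi> \<alpha>)" for X
  have N_in: "N X \<in> E" for X unfolding N_def using \<nu> by (intro E.closed) auto
  have P_in: "P X \<in> V" for X unfolding P_def using \<xi> by (intro V.closed) auto
  have JD: "J (D X) = D (T X) + N X" if "X \<in> V" for X using JD[OF that] by (simp add: N_def)
  have comb_normal: "g (\<Sum>\<alpha>=1..r. k \<alpha> *\<^sub>R \<nu> \<alpha>) (D Y) = 0" if "Y \<in> V" for k Y
    using that D(2) \<nu> \<nu>_normal by (subst E.lincomb_left) auto
  have comb_\<nu>: "g (\<Sum>\<alpha>=1..r. k \<alpha> *\<^sub>R \<nu> \<alpha>) (\<nu> \<beta>) = k \<beta>" if "\<beta> \<in> {1..r}" for k \<beta>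
  proof -
    have "g (\<Sum>\<alpha>=1..r. k \<alpha> *\<^sub>R \<nu> \<alpha>) (\<nu> \<beta>) = (\<Sum>\<alpha>=1..r. k \<alpha> * g (\<nu> \<alpha>) (\<nu> \<beta>))"
      using that \<nu> by (intro E.lincomb_left) auto
    also have "\<dots> = (\<Sum>\<alpha>=1..r. if \<alpha> = \<beta> then k \<alpha> else 0)"
      using that \<nu>_orth by (intro sum.cong) auto
    also have "\<dots> = k \<beta>" using that by simp
    finally show ?thesis .
  qed
  have N_normal: "g (N X) (D Y) = 0" if "Y \<in> V" for X Y
    unfolding N_def by (rule comb_normal[OF that])
  have gJ: "g (J (D X)) (D Y) = h (T X) Y" if "X \<in> V" "Y \<in> V" for X Y
    using that JD[of X] N_normal[of Y] N_in[of X] D(2) T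
    by (simp add: E.add_left iso)
  have T_adj: "h (T X) Y = h X (T Y)" if "X \<in> V" "Y \<in> V" for X Y
    using that gJ[of X Y] gJ[of Y X] J_adj[of "D X" "D Y"] E.sym[of "D X" "J (D Y)"]
      D(2) J_in V.sym[of X "T Y"] T by simp
  have \<eta>: "\<eta> \<alpha> X = h (\<xi> \<alpha>) X" if "X \<in> V" "\<alpha> \<in> {1..r}" for X \<alpha>
  proof -
    have "\<eta> \<alpha> X = g (N X) (\<nu> \<alpha>)" using comb_\<nu>[OF that(2)] by (simp add: N_def)
    also have "\<dots> = g (J (D X)) (\<nu> \<alpha>)"
      using that JD[of X] N_in[of X] \<nu>_normal[of \<alpha> "T X"] E.sym[of "\<nu> \<alpha>" "D (T X)"] D(2) T \<nu>
      by (simp add: E.add_left)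
    also have "\<dots> = g (J (\<nu> \<alpha>)) (D X)"
      using that J_adj[of "\<nu> \<alpha>" "D X"] E.sym[of "J (D X)" "\<nu> \<alpha>"] D(2) \<nu> J_in by simp
    also have "\<dots> = g (D (\<xi> \<alpha>)) (D X) + g (\<Sum>\<beta>=1..r. a \<alpha> \<beta> *\<^sub>R \<nu> \<beta>) (D X)"
      unfolding J\<nu>[OF that(2)] using that D(2) \<xi> \<nu> by (intro E.add_left E.closed) auto
    also have "\<dots> = h (\<xi> \<alpha>) X" using comb_normal that iso \<xi> by simp
    finally show ?thesis .
  qed
  have hP: "h (P X) Y = (\<Sum>\<alpha>=1..r. \<eta> \<alpha> X * \<eta> \<alpha> Y)" if "X \<in> V" "Y \<in> V" for X Y
    unfolding P_def using that \<xi> \<eta> by (subst V.lincomb_left) (auto intro!: sum.cong)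
  have gN: "g (N X) (N X) = h (P X) X" if "X \<in> V" for X
  proof -
    have "g (N X) (N X) = (\<Sum>\<alpha>=1..r. \<eta> \<alpha> X * g (N X) (\<nu> \<alpha>))"
      using N_in \<nu> by (subst (2) N_def, intro E.lincomb_right) auto
    also have "\<dots> = h (P X) X"
      unfolding hP[OF that that] N_def using comb_\<nu> by (intro sum.cong) auto
    finally show ?thesis .
  qed
  have norms: "(sin \<theta>)\<^sup>2 * h (T X) (T X) = (cos \<theta>)\<^sup>2 * h (P X) X" if X: "X \<in> V" for X
  proof (cases "X = 0")
    case True
    \<comment> \<open>the angle of the zero vector is unconstrained, but both sides vanish by self-adjointness\<close>
    have "h (T X) (T X) = h (T (T X)) X" using T_adj[of "T X" X] T X by simp
    then show ?thesis using True T X P_in V.zero_right by simp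
  next
    case False
    have "D X \<noteq> 0" using iso[OF X X] V.pos[OF X False] E.zero_left[OF E.closed(1)] by auto
    then have nz: "J (D X) \<noteq> 0" using J_inj D(2) X by blast
    have "g (D (T X)) (D (T X)) = (cos (angle_to_subspace g (D ` V) (J (D X))))\<^sup>2 * g (J (D X)) (J (D X))"
    proof (rule E.cos_angle_to_subspace[OF _ _ _ nz])
      show "subspace (D ` V)" using subspace_linear_image[OF V.subspace D(1)] .
      show "g (J (D X) - D (T X)) u = 0" if "u \<in> D ` V" for u
        using that JD[OF X] N_normal by auto
    qed (use D(2) J_in X T in auto)
    also have "g (J (D X)) (J (D X)) = g (D (T X)) (D (T X)) + g (N X) (N X)"
      unfolding JD[OF X] using D(2) T X N_in N_normal by (intro E.pythagoras) auto
    finally have "h (T X) (T X) = (cos \<theta>)\<^sup>2 * (h (T X) (T X) + h (P X) X)"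
      using angle[OF X False] gN[OF X] iso T X by simp
    then show ?thesis by (simp add: sin_squared_eq algebra_simps)
  qed
  define S where "S X = (sin \<theta>)\<^sup>2 *\<^sub>R T (T X) - (cos \<theta>)\<^sup>2 *\<^sub>R P X" for X
  have hS: "h (S X) Y = (sin \<theta>)\<^sup>2 * h (T X) (T Y) - (cos \<theta>)\<^sup>2 * h (P X) Y" if "X \<in> V" "Y \<in> V" for X Y
    unfolding S_def using that T P_in V.closed T_adj
    by (simp add: V.diff_left V.scale_left)
  have "S X = 0"
  proof (rule V.self_adjoint_eq_zero[OF _ _ _ X])
    show S_in: "S Y \<in> V" if "Y \<in> V" for Y
      unfolding S_def using that T P_in by (intro V.closed) auto
    show "h (S Y) Y = 0" if "Y \<in> V" for Y using hS norms that by simp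
    show "h (S Y) Z = h Y (S Z)" if "Y \<in> V" "Z \<in> V" for Y Z
      using that hS[of Y Z] hS[of Z Y] V.sym[of Y "S Z"] S_in V.sym[of "T Y" "T Z"] T
      by (simp add: hP mult.commute)
  qed
  then have "(sin \<theta>)\<^sup>2 *\<^sub>R T (T X) = (cos \<theta>)\<^sup>2 *\<^sub>R P X" by (simp add: S_def)
  then have "(1 / (sin \<theta>)\<^sup>2) *\<^sub>R (sin \<theta>)\<^sup>2 *\<^sub>R T (T X) = (1 / (sin \<theta>)\<^sup>2) *\<^sub>R (cos \<theta>)\<^sup>2 *\<^sub>R P X"
    by simp
  then have "T (T X) = ((cos \<theta>)\<^sup>2 / (sin \<theta>)\<^sup>2) *\<^sub>R P X" using sin by simp
  then show ?thesis by (simp add: P_def tan_def power_divide)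
qed

section \<open>Tangent spaces and differentials\<close>

lemma smooth_on_differentiable: "smooth_on S h \<Longrightarrow> y \<in> S \<Longrightarrow> h differentiable (at y)"
  unfolding smooth_on_def by (metis Ck_on.simps(2))

lemma chart_inv_chart: "is_chart X c \<Longrightarrow> x \<in> fst c \<Longrightarrow> chart_inv c (snd c x) = x"
  unfolding is_chart_def chart_inv_def
  by (metis homeomorphic_imp_injective_map inv_into_f_f openin_subset topspace_subtopology_subset)

lemma open_chart_image:
  assumes "is_chart X c" "openin X A" "A \<subseteq> fst c"
  shows "open (snd c ` A)"
proof -
  have "openin (subtopology X (fst c)) A"
    using assms by (simp add: openin_open_subtopology is_chart_def)
  then have "openin (top_of_set (snd c ` fst c)) (snd c ` A)"
    using assms(1) homeomorphic_imp_open_map unfolding is_chart_def open_map_def by blast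
  then show ?thesis using assms(1) openin_open_trans unfolding is_chart_def by blast
qed

lemma charts_atD: "smooth_manifold M \<Longrightarrow> c \<in> charts_at M x \<Longrightarrow>
    c \<in> atlas M \<and> x \<in> fst c \<and> is_chart (topo M) c"
  unfolding smooth_manifold_def charts_at_def by auto

lemma charts_at_nonempty:
  "smooth_manifold M \<Longrightarrow> x \<in> topspace (topo M) \<Longrightarrow> charts_at M x \<noteq> {}"
  unfolding smooth_manifold_def charts_at_def by blast

lemma transition_differentiable:
  assumes "smooth_manifold M" "c \<in> charts_at M x" "d \<in> charts_at M x"
  shows "(snd d \<circ> chart_inv c) differentiable (at (snd c x))"
proof -
  have "smooth_on (snd c ` (fst c \<inter> fst d)) (snd d \<circ> chart_inv c)"
    using assms unfolding smooth_manifold_def charts_at_def by blast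
  then show ?thesis using assms(2,3) by (auto simp: charts_at_def intro!: smooth_on_differentiable)
qed

lemma chart_expression_differentiable:
  assumes "smooth_map M N f" "x \<in> topspace (topo M)" "c \<in> charts_at M x" "d \<in> charts_at N (f x)"
  shows "(snd d \<circ> f \<circ> chart_inv c) differentiable (at (snd c x))"
proof -
  have "smooth_on (snd c ` (fst c \<inter> (topspace (topo M) \<inter> f -` fst d))) (snd d \<circ> f \<circ> chart_inv c)"
    using assms unfolding smooth_map_def smooth_fun_on_def charts_at_def by blast
  then show ?thesis
    using assms(2-4) by (auto simp: charts_at_def intro!: smooth_on_differentiable)
qed

lemma tangent_vector_eqI:
  assumes "v \<in> tangent_space M x" "w \<in> tangent_space M x" "c \<in> charts_at M x" "v c = w c"
  shows "v = w"
proof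
  fix d show "v d = w d"
  proof (cases "d \<in> charts_at M x")
    case True
    then have "v d = frechet_derivative (snd d \<circ> chart_inv c) (at (snd c x)) (v c)"
      "w d = frechet_derivative (snd d \<circ> chart_inv c) (at (snd c x)) (w c)"
      using assms(1-3) unfolding tangent_space_def by blast+
    then show ?thesis by (simp only: assms(4))
  next
    case False
    then have "v d = 0" "w d = 0" using assms(1,2) unfolding tangent_space_def by blast+
    then show ?thesis by simp
  qed
qed

lemma subspace_tangent_space:
  assumes M: "smooth_manifold M"
  shows "subspace (tangent_space M x)"
proof -
  have lin: "Real_Vector_Spaces.linear (frechet_derivative (snd d \<circ> chart_inv c) (at (snd c x)))"
    if "c \<in> charts_at M x" "d \<in> charts_at M x" for c d
    using transition_differentiable[OF M that] by (rule linear_frechet_derivative)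
  show ?thesis
    unfolding subspace_def
  proof (intro conjI ballI allI)
    show "0 \<in> tangent_space M x"
      unfolding tangent_space_def using linear_0[OF lin] by (simp only: mem_Collect_eq zero_fun_apply) simp
    show "u + v \<in> tangent_space M x" if "u \<in> tangent_space M x" "v \<in> tangent_space M x" for u v
      using that linear_add[OF lin] unfolding tangent_space_def
      by (simp only: mem_Collect_eq plus_fun_apply) (metis add.right_neutral)
    show "t *\<^sub>R u \<in> tangent_space M x" if "u \<in> tangent_space M x" for t u
      using that linear_scale[OF lin] unfolding tangent_space_def
      by (simp only: mem_Collect_eq scaleR_fun_def) (metis scaleR_zero_right)
  qed
qed

text \<open>Evaluation in one chart embeds the tangent space into the model space.\<close>

lemma tangent_space_finitely_spanned:
  assumes M: "smooth_manifold M" and x: "x \<in> topspace (topo M)"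
  shows "\<exists>B. finite B \<and> span B = tangent_space M x"
proof -
  obtain c where c: "c \<in> charts_at M x" using charts_at_nonempty[OF M x] by blast
  show ?thesis
  proof (rule finitely_spanned_if_injects[where e = "\<lambda>v. v c"])
    show "subspace (tangent_space M x)" by (rule subspace_tangent_space[OF M])
    show "linear_on_subspace (tangent_space M x) (\<lambda>v. v c)"
      unfolding linear_on_subspace_def by (simp add: scaleR_fun_def)
    show "inj_on (\<lambda>v. v c) (tangent_space M x)"
      by (rule inj_onI) (rule tangent_vector_eqI[OF _ _ c])
  qed
qed

text \<open>Linearity holds on every set of families of coordinate vectors, tangent or not: the differential
  evaluates the family in one chart and applies a derivative to the result.\<close>

lemma linear_differential:
  assumes M: "smooth_manifold M" and f: "smooth_map M N f" and x: "x \<in> topspace (topo M)"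
  shows "linear_on_subspace V (differential M N f x)"
proof -
  define c where "c = (SOME c. c \<in> charts_at M x)"
  have c: "c \<in> charts_at M x" using charts_at_nonempty[OF M x] by (simp add: c_def some_in_eq)
  have lin: "Real_Vector_Spaces.linear (frechet_derivative (snd d \<circ> f \<circ> chart_inv c) (at (snd c x)))"
    if "d \<in> charts_at N (f x)" for d
    using chart_expression_differentiable[OF f x c that] by (rule linear_frechet_derivative)
  show ?thesis
    unfolding linear_on_subspace_def differential_def c_def[symmetric] Let_def
  proof (intro conjI ballI allI ext, goal_cases)
    case (1 u v d)
    show ?case
    proof (cases "d \<in> charts_at N (f x)")
      case True
      show ?thesis using linear_add[OF lin[OF True]] by (simp only: plus_fun_apply True if_True)
    next
      case False
      then show ?thesis by (simp only: plus_fun_apply if_False add_0)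
    qed
  next
    case (2 t v d)
    show ?case
    proof (cases "d \<in> charts_at N (f x)")
      case True
      show ?thesis using linear_scale[OF lin[OF True]] by (simp only: scaleR_fun_def True if_True)
    next
      case False
      then show ?thesis by (simp only: scaleR_fun_def if_False scaleR_zero_right)
    qed
  qed
qed

text \<open>Near \<open>x\<close> the two chart expressions of \<open>f\<close> differ by the change of charts, which makes the values
  of the differential transform like a tangent vector.\<close>

lemma frechet_derivative_change_chart:
  assumes M: "smooth_manifold M" and N: "smooth_manifold N" and f: "smooth_map M N f"
    and x: "x \<in> topspace (topo M)" and c: "c \<in> charts_at M x"
    and d: "d \<in> charts_at N (f x)" and d': "d' \<in> charts_at N (f x)"
  shows "frechet_derivative (snd d' \<circ> f \<circ> chart_inv c) (at (snd c x)) u =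
    frechet_derivative (snd d' \<circ> chart_inv d) (at (snd d (f x)))
      (frechet_derivative (snd d \<circ> f \<circ> chart_inv c) (at (snd c x)) u)"
proof -
  note cM = charts_atD[OF M c] and dN = charts_atD[OF N d]
  define A where "A = fst c \<inter> {y \<in> topspace (topo M). f y \<in> fst d}"
  have "openin (topo M) A"
    using cM dN f unfolding A_def is_chart_def smooth_map_def
    by (intro openin_Int openin_continuous_map_preimage) auto
  then have opn: "open (snd c ` A)" using open_chart_image[of "topo M" c A] cM A_def by blast
  have inv: "chart_inv c (snd c y) = y" if "y \<in> fst c" for y
    using chart_inv_chart that cM by metis
  have inv_d: "chart_inv d (snd d y) = y" if "y \<in> fst d" for y
    using chart_inv_chart that dN by metis
  have xA: "snd c x \<in> snd c ` A" using x cM dN by (auto simp: A_def)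
  let ?F = "snd d \<circ> f \<circ> chart_inv c" and ?G = "snd d' \<circ> chart_inv d"
  have Fx: "?F (snd c x) = snd d (f x)" using inv cM by simp
  have "(?F has_derivative frechet_derivative ?F (at (snd c x))) (at (snd c x))"
    using chart_expression_differentiable[OF f x c d] by (simp only: frechet_derivative_works)
  moreover have "(?G has_derivative frechet_derivative ?G (at (snd d (f x)))) (at (?F (snd c x)))"
    using iffD1[OF frechet_derivative_works transition_differentiable[OF N d d']] Fx by (simp only:)
  ultimately have "(?G \<circ> ?F has_derivative
      frechet_derivative ?G (at (snd d (f x))) \<circ> frechet_derivative ?F (at (snd c x))) (at (snd c x))"
    by (rule diff_chain_at)
  then have "(snd d' \<circ> f \<circ> chart_inv c has_derivative
      frechet_derivative ?G (at (snd d (f x))) \<circ> frechet_derivative ?F (at (snd c x))) (at (snd c x))"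
    by (rule has_derivative_transform_within_open[OF _ opn xA]) (auto simp: A_def inv inv_d)
  from frechet_derivative_at[OF this, symmetric] show ?thesis by simp
qed

lemma differential_in_tangent_space:
  assumes M: "smooth_manifold M" and N: "smooth_manifold N" and f: "smooth_map M N f"
    and x: "x \<in> topspace (topo M)"
  shows "differential M N f x v \<in> tangent_space N (f x)"
proof -
  define c where "c = (SOME c. c \<in> charts_at M x)"
  have c: "c \<in> charts_at M x" using charts_at_nonempty[OF M x] by (simp add: c_def some_in_eq)
  show ?thesis
    unfolding tangent_space_def differential_def c_def[symmetric] Let_def
  proof (intro CollectI conjI ballI allI impI, goal_cases)
    case (1 d d')
    then show ?case using frechet_derivative_change_chart[OF M N f x c 1] by (simp only: if_True)
  next
    case (2 d)
    then show ?case by simp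
  qed
qed

lemma inner_product_on_tangent_space:
  assumes "smooth_manifold M" "riemannian_metric M g" "x \<in> topspace (topo M)"
  shows "inner_product_on (tangent_space M x) (g x)"
proof
  show "subspace (tangent_space M x)" by (rule subspace_tangent_space[OF assms(1)])
qed (use assms(2,3) in \<open>unfold riemannian_metric_def, blast\<close>)+

section \<open>Metallic structures and slant immersions\<close>

text \<open>\<open>J\<close> is invertible, since \<open>J(J - p) = q\<close> with \<open>q \<noteq> 0\<close>.\<close>

lemma metallic_injective:
  assumes metallic: "metallic_riemannian_manifold M J g p q" and x: "x \<in> topspace (topo M)"
    and X: "X \<in> tangent_space M x" and JX: "J x X = 0"
  shows "X = 0"
proof -
  have M: "smooth_manifold M" and J: "tensor_field_1_1 M J"
    using metallic unfolding metallic_riemannian_manifold_def by blast+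
  have "linear_on_subspace (tangent_space M x) (J x)"
    using J x unfolding tensor_field_1_1_def by blast
  then have "J x 0 = 0" by (rule linear_on_subspace_zero[OF subspace_tangent_space[OF M]])
  moreover have "J x (J x X) = real p *\<^sub>R J x X + real q *\<^sub>R X" "q > 0"
    using metallic x X unfolding metallic_riemannian_manifold_def by blast+
  ultimately show ?thesis using JX by simp
qed

text \<open>A vector at angle \<open>0\<close> to a subspace is as long as its projection, so it equals its projection.\<close>

lemma slant_angle_zero_imp_invariant:
  assumes metallic: "metallic_riemannian_manifold N J g p q" and M: "smooth_manifold M"
    and f: "smooth_map M N f" and slant: "slant_submanifold M N J g f 0"
  shows "invariant_submanifold M N J f"
  unfolding invariant_submanifold_def
proof (intro ballI subsetI)
  fix x v assume x: "x \<in> topspace (topo M)" and v: "v \<in> J (f x) ` immersed_tangent_space M N f x"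
  let ?D = "differential M N f x" and ?W = "immersed_tangent_space M N f x"
  have N: "smooth_manifold N" "riemannian_metric N g" "tensor_field_1_1 N J"
    using metallic unfolding metallic_riemannian_manifold_def by auto
  have fx: "f x \<in> topspace (topo N)"
    using f x unfolding smooth_map_def by (auto dest: continuous_map_image_subset_topspace)
  interpret N: inner_product_on "tangent_space N (f x)" "g (f x)"
    by (rule inner_product_on_tangent_space[OF N(1,2) fx])
  obtain B where B: "finite B" "span B = tangent_space M x"
    using tangent_space_finitely_spanned[OF M x] by blast
  have W: "?W = span (?D ` B)"
    unfolding immersed_tangent_space_def B(2)[symmetric]
    by (rule linear_image_span[OF linear_differential[OF M f x]])
  have WN: "?W \<subseteq> tangent_space N (f x)"
    unfolding immersed_tangent_space_def
    using differential_in_tangent_space[OF M N(1) f x] by blast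
  obtain X where X: "X \<in> tangent_space M x" "v = J (f x) (?D X)"
    using v unfolding immersed_tangent_space_def by blast
  show "v \<in> ?W"
  proof (cases "v = 0")
    case True
    then show ?thesis using W span_0 by simp
  next
    case False
    have J: "J (f x) ` tangent_space N (f x) \<subseteq> tangent_space N (f x)"
      "linear_on_subspace (tangent_space N (f x)) (J (f x))"
      using N(3) fx unfolding tensor_field_1_1_def by auto
    have "X \<noteq> 0"
    proof
      assume "X = 0"
      then have "?D X = 0"
        using linear_on_subspace_zero[OF subspace_UNIV linear_differential[OF M f x]] by (simp only:)
      then show False using False X(2) linear_on_subspace_zero[OF N.subspace J(2)] by simp
    qed
    then have "angle_to_subspace (g (f x)) ?W v = 0"
      using slant x X unfolding slant_submanifold_def by blast
    moreover have "v \<in> tangent_space N (f x)"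
      unfolding X(2) using J(1) differential_in_tangent_space[OF M N(1) f x] by blast
    ultimately show ?thesis
      using N.in_subspace_if_angle_zero[OF _ W WN _ False] B(1) by blast
  qed
qed

theorem proposition3p26:
  fixes M :: "('m, 'a::euclidean_space) manifold"
    and Mbar :: "('k, 'b::euclidean_space) manifold"
    and J :: "('k, 'b) endo_field" and g :: "('k, 'b) metric_field"
    and gM :: "('m, 'a) metric_field" and f :: "'m \<Rightarrow> 'k"
    and n r p q :: nat and \<theta> :: real and U :: "'m set"
    and \<nu> :: "nat \<Rightarrow> 'm \<Rightarrow> ('k, 'b) tvec"
    and T :: "('m, 'a) endo_field"
    and \<eta> :: "nat \<Rightarrow> 'm \<Rightarrow> ('m, 'a) tvec \<Rightarrow> real"
    and \<xi> :: "nat \<Rightarrow> 'm \<Rightarrow> ('m, 'a) tvec"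
    and a :: "nat \<Rightarrow> nat \<Rightarrow> 'm \<Rightarrow> real"
  assumes "metallic_riemannian_manifold Mbar J g p q"
    and "smooth_manifold M" and "riemannian_metric M gM"
    and "DIM('a) = n" and "DIM('b) = n + r"
    and "isometric_immersion M gM Mbar g f"
    and "openin (topo M) U"
    and "orthonormal_normal_frame M Mbar g f U r \<nu>"
    and "induced_structure M Mbar J f U r \<nu> T \<eta> \<xi> a"
    and "proper_slant_submanifold M Mbar J g f \<theta>"
  shows "\<forall>x\<in>U. \<forall>X\<in>tangent_space M x.
           T x (T x X) = (1 / (tan \<theta>)\<^sup>2) *\<^sub>R (\<Sum>\<alpha>=1..r. \<eta> \<alpha> x X *\<^sub>R \<xi> \<alpha> x)"
proof (intro ballI)
  fix x X assume xU: "x \<in> U" and X: "X \<in> tangent_space M x"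
  have N: "smooth_manifold Mbar" "riemannian_metric Mbar g" "tensor_field_1_1 Mbar J"
    using assms(1) unfolding metallic_riemannian_manifold_def by auto
  have x: "x \<in> topspace (topo M)" using assms(7) xU openin_subset by blast
  have f: "smooth_map M Mbar f"
    using assms(6) unfolding isometric_immersion_def immersion_def by blast
  have fx: "f x \<in> topspace (topo Mbar)"
    using f x unfolding smooth_map_def by (auto dest: continuous_map_image_subset_topspace)
  have slant: "slant_submanifold M Mbar J g f \<theta>" "\<not> invariant_submanifold M Mbar J f"
    using assms(10) unfolding proper_slant_submanifold_def by auto
  have "\<theta> \<noteq> 0" using slant_angle_zero_imp_invariant[OF assms(1,2) f] slant by blast
  then have "0 < \<theta>" "\<theta> < pi"
    using slant(1) pi_gt_zero unfolding slant_submanifold_def by linarith+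
  then have sin: "sin \<theta> \<noteq> 0" using sin_gt_zero by force
  let ?D = "differential M Mbar f x"
  note frame = assms(8)[unfolded orthonormal_normal_frame_def]
  note induced = assms(9)[unfolded induced_structure_def]
  have \<nu>: "\<nu> \<alpha> x \<in> normal_space M Mbar g f x" if "\<alpha> \<in> {1..r}" for \<alpha>
  proof -
    have "span ((\<lambda>\<alpha>. \<nu> \<alpha> x) ` {1..r}) = normal_space M Mbar g f x" using frame xU by blast
    moreover have "\<nu> \<alpha> x \<in> span ((\<lambda>\<alpha>. \<nu> \<alpha> x) ` {1..r})" using that by (intro span_base imageI)
    ultimately show ?thesis by simp
  qed
  show "T x (T x X) = (1 / (tan \<theta>)\<^sup>2) *\<^sub>R (\<Sum>\<alpha>=1..r. \<eta> \<alpha> x X *\<^sub>R \<xi> \<alpha> x)"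
  proof (rule slant_square_identity[where E = "tangent_space Mbar (f x)" and V = "tangent_space M x"
        and g = "g (f x)" and h = "gM x" and D = ?D and J = "J (f x)" and T = "T x"
        and \<nu> = "\<lambda>\<alpha>. \<nu> \<alpha> x" and \<xi> = "\<lambda>\<alpha>. \<xi> \<alpha> x" and \<eta> = "\<lambda>\<alpha>. \<eta> \<alpha> x" and a = "\<lambda>\<alpha> \<beta>. a \<alpha> \<beta> x",
        OF inner_product_on_tangent_space[OF N(1,2) fx] inner_product_on_tangent_space[OF assms(2,3) x]
          linear_differential[OF assms(2) f x] differential_in_tangent_space[OF assms(2) N(1) f x]
          _ _ metallic_injective[OF assms(1) fx] _ _ _ _ _ _ _ _ _ sin X])
    show "gM x Y Z = g (f x) (?D Y) (?D Z)" if "Y \<in> tangent_space M x" "Z \<in> tangent_space M x" for Y Z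
      using assms(6) x that unfolding isometric_immersion_def by blast
    show "J (f x) u \<in> tangent_space Mbar (f x)" if "u \<in> tangent_space Mbar (f x)" for u
      using N(3) fx that unfolding tensor_field_1_1_def by blast
    show "g (f x) (J (f x) u) v = g (f x) u (J (f x) v)"
      if "u \<in> tangent_space Mbar (f x)" "v \<in> tangent_space Mbar (f x)" for u v
      using assms(1) fx that unfolding metallic_riemannian_manifold_def by blast
    show "\<nu> \<alpha> x \<in> tangent_space Mbar (f x)" if "\<alpha> \<in> {1..r}" for \<alpha>
      using \<nu>[OF that] by (simp add: normal_space_def)
    show "g (f x) (\<nu> \<alpha> x) (?D Y) = 0" if "\<alpha> \<in> {1..r}" "Y \<in> tangent_space M x" for \<alpha> Y
      using \<nu>[OF that(1)] that(2) by (simp add: normal_space_def immersed_tangent_space_def)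
    show "g (f x) (\<nu> \<alpha> x) (\<nu> \<beta> x) = (if \<alpha> = \<beta> then 1 else 0)" if "\<alpha> \<in> {1..r}" "\<beta> \<in> {1..r}" for \<alpha> \<beta>
      using frame xU that by blast
    show "angle_to_subspace (g (f x)) (?D ` tangent_space M x) (J (f x) (?D Y)) = \<theta>"
      if "Y \<in> tangent_space M x" "Y \<noteq> 0" for Y
      using slant(1) x that unfolding slant_submanifold_def immersed_tangent_space_def by blast
  qed (use induced xU in blast)+
qed

end
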